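(* Let $G$ be any group. Every contractible $G$-subshift of finite type has the finite extension property (FEP).
   Context: For a finite set $A$ (alphabet) and a group $G$, $A^G$ carries the product topology (discrete $A$) and the shift action $(gx)_h = x_{g^{-1}h}$. A subshift is a topologically closed, shift-invariant subset $X \subset A^G$. A pattern is an element $p \in A^D$ with $D \subset G$; it is finite if $D$ is. A finite pattern $q \in A^W$ appears in a pattern $p \in A^E$ if for some $g \in G$ with $gW \subset E$ one has $p_{gw} = q_w$ for all $w \in W$. $X$ is a subshift of finite type (SFT) if there are a finite set $W \subset G$ (a window for $X$) and a set $\mathcal{F} \subset A^W$ of forbidden patterns such that $X$ is the set of $x \in A^G$ in which no pattern from $\mathcal{F}$ appears. Given the window $W$, one takes $\mathcal{F}$ to be the set of all patterns in $A^W$ that do not appear in any configuration of $X$. A pattern $p \in A^E$ is locally valid (with respect to $W$) if no element of $\mathcal{F}$ appears in it, and globally valid if $p = x|_E$ for some $x \in X$. An SFT $X \subset A^G$ has the finite extension property (FEP) if for some window $W$ for $X$ there exists a finite set $N \subset G$ with $1_G \in N$ such that for every nonempty $D \subset G$ and every pattern $p \in A^D$: if $p$ is the restriction to $D$ of some locally valid pattern with domain $DN$, then $p$ is globally valid. A block map between $G$-subshifts is a continuous shift-commuting map; products carry the diagonal action. Let $I = \{0,1\}^G$, and let $\bar 0, \bar 1 \in I$ be the constant configurations. A subshift $X$ is contractible if there is a block map $h : I \times X \times X \to X$ with $h(\bar 0, x, y) = x$ and $h(\bar 1, x, y) = y$ for all $x, y \in X$. *)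

theory Defs
  imports "HOL-Analysis.Function_Topology" "HOL-Analysis.Product_Topology" "HOL-Algebra.Coset"
begin

text \<open>
  A pattern in \<open>A\<^sup>D\<close> (for \<open>D \<subseteq> carrier G\<close>) is an element of \<open>D \<rightarrow>\<^sub>E A\<close>, that is, a function
  that is \<open>undefined\<close> outside \<open>D\<close>; configurations are the patterns with domain \<open>carrier G\<close>.
  The topspace of the following topology is thus \<open>carrier G \<rightarrow>\<^sub>E A\<close>.
\<close>

definition full_shift :: "('g, 'm) monoid_scheme \<Rightarrow> 'a set \<Rightarrow> ('g \<Rightarrow> 'a) topology" where
  "full_shift G A = product_topology (\<lambda>_. discrete_topology A) (carrier G)"

definition shift :: "('g, 'm) monoid_scheme \<Rightarrow> 'g \<Rightarrow> ('g \<Rightarrow> 'a) \<Rightarrow> 'g \<Rightarrow> 'a" where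
  "shift G g x = (\<lambda>h\<in>carrier G. x (inv\<^bsub>G\<^esub> g \<otimes>\<^bsub>G\<^esub> h))"

definition subshift :: "('g, 'm) monoid_scheme \<Rightarrow> 'a set \<Rightarrow> ('g \<Rightarrow> 'a) set \<Rightarrow> bool" where
  "subshift G A X \<longleftrightarrow>
     closedin (full_shift G A) X \<and> (\<forall>g\<in>carrier G. \<forall>x\<in>X. shift G g x \<in> X)"

text \<open>The pattern \<open>q\<close> with domain \<open>W\<close> appears in the pattern \<open>p\<close> with domain \<open>E\<close>.\<close>

definition appears ::
  "('g, 'm) monoid_scheme \<Rightarrow> 'g set \<Rightarrow> ('g \<Rightarrow> 'a) \<Rightarrow> 'g set \<Rightarrow> ('g \<Rightarrow> 'a) \<Rightarrow> bool" where
  "appears G W q E p \<longleftrightarrow>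
     (\<exists>g\<in>carrier G. g <#\<^bsub>G\<^esub> W \<subseteq> E \<and> (\<forall>w\<in>W. p (g \<otimes>\<^bsub>G\<^esub> w) = q w))"

definition is_window ::
  "('g, 'm) monoid_scheme \<Rightarrow> 'a set \<Rightarrow> ('g \<Rightarrow> 'a) set \<Rightarrow> 'g set \<Rightarrow> bool" where
  "is_window G A X W \<longleftrightarrow>
     finite W \<and> W \<subseteq> carrier G \<and>
     (\<exists>F \<subseteq> W \<rightarrow>\<^sub>E A. X = {x \<in> carrier G \<rightarrow>\<^sub>E A. \<forall>q\<in>F. \<not> appears G W q (carrier G) x})"

definition sft :: "('g, 'm) monoid_scheme \<Rightarrow> 'a set \<Rightarrow> ('g \<Rightarrow> 'a) set \<Rightarrow> bool" where
  "sft G A X \<longleftrightarrow> subshift G A X \<and> (\<exists>W. is_window G A X W)"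

text \<open>
  Once the window is fixed, the forbidden patterns are taken to be all patterns on it that
  appear in no configuration of \<open>X\<close>.
\<close>

definition forbidden ::
  "('g, 'm) monoid_scheme \<Rightarrow> 'a set \<Rightarrow> ('g \<Rightarrow> 'a) set \<Rightarrow> 'g set \<Rightarrow> ('g \<Rightarrow> 'a) set" where
  "forbidden G A X W = {q \<in> W \<rightarrow>\<^sub>E A. \<forall>x\<in>X. \<not> appears G W q (carrier G) x}"

definition locally_valid ::
  "('g, 'm) monoid_scheme \<Rightarrow> 'a set \<Rightarrow> ('g \<Rightarrow> 'a) set \<Rightarrow> 'g set \<Rightarrow> 'g set \<Rightarrow> ('g \<Rightarrow> 'a) \<Rightarrow> bool" where
  "locally_valid G A X W E p \<longleftrightarrow>
     p \<in> E \<rightarrow>\<^sub>E A \<and> (\<forall>q\<in>forbidden G A X W. \<not> appears G W q E p)"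

definition globally_valid :: "('g \<Rightarrow> 'a) set \<Rightarrow> 'g set \<Rightarrow> ('g \<Rightarrow> 'a) \<Rightarrow> bool" where
  "globally_valid X E p \<longleftrightarrow> (\<exists>x\<in>X. p = restrict x E)"

definition fep :: "('g, 'm) monoid_scheme \<Rightarrow> 'a set \<Rightarrow> ('g \<Rightarrow> 'a) set \<Rightarrow> bool" where
  "fep G A X \<longleftrightarrow>
     (\<exists>W. is_window G A X W \<and>
       (\<exists>N. finite N \<and> N \<subseteq> carrier G \<and> \<one>\<^bsub>G\<^esub> \<in> N \<and>
         (\<forall>D p. D \<subseteq> carrier G \<and> D \<noteq> {} \<and> p \<in> D \<rightarrow>\<^sub>E A \<and>
            (\<exists>q. locally_valid G A X W (D <#>\<^bsub>G\<^esub> N) q \<and> p = restrict q D)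
            \<longrightarrow> globally_valid X D p)))"

text \<open>
  Block maps are defined for arbitrary topological spaces with an action of \<open>G\<close>
  (\<open>a\<close> on the domain, \<open>b\<close> on the codomain), so as to cover products of subshifts with
  the diagonal action.
\<close>

definition block_map ::
  "('g, 'm) monoid_scheme \<Rightarrow> 'x topology \<Rightarrow> ('g \<Rightarrow> 'x \<Rightarrow> 'x) \<Rightarrow>
     'y topology \<Rightarrow> ('g \<Rightarrow> 'y \<Rightarrow> 'y) \<Rightarrow> ('x \<Rightarrow> 'y) \<Rightarrow> bool" where
  "block_map G S a T b f \<longleftrightarrow>
     continuous_map S T f \<and> (\<forall>g\<in>carrier G. \<forall>x\<in>topspace S. f (a g x) = b g (f x))"

definition contractible_subshift ::
  "('g, 'm) monoid_scheme \<Rightarrow> 'a set \<Rightarrow> ('g \<Rightarrow> 'a) set \<Rightarrow> bool" where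
  "contractible_subshift G A X \<longleftrightarrow> subshift G A X \<and>
     (\<exists>h :: ('g \<Rightarrow> nat) \<times> ('g \<Rightarrow> 'a) \<times> ('g \<Rightarrow> 'a) \<Rightarrow> ('g \<Rightarrow> 'a).
       block_map G
         (prod_topology (full_shift G {0, 1})
           (prod_topology (subtopology (full_shift G A) X) (subtopology (full_shift G A) X)))
         (\<lambda>g. map_prod (shift G g) (map_prod (shift G g) (shift G g)))
         (subtopology (full_shift G A) X) (shift G) h \<and>
       (\<forall>x\<in>X. \<forall>y\<in>X. h ((\<lambda>_\<in>carrier G. 0), x, y) = x \<and> h ((\<lambda>_\<in>carrier G. 1), x, y) = y))"

end

theory Submission
  imports Defs
begin

text \<open>
  A locally valid pattern \<open>q\<close> on \<open>DN\<close> is contracted onto a fixed configuration \<open>x\<^sub>0 \<in> X\<close> away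
  from \<open>D\<close>: one applies the local rule of the contraction \<open>h\<close> to \<open>(\<phi>, q, x\<^sub>0)\<close>, where \<open>\<phi>\<close> vanishes
  near \<open>D\<close> and is \<open>1\<close> elsewhere. By compactness, for \<open>N\<close> large enough, every patch of \<open>q\<close> of a
  given finite shape lying close to \<open>D\<close> extends to a configuration of \<open>X\<close>, so each patch of the
  result on a translate of the window is a patch of some \<open>h(\<phi>, x, x\<^sub>0) \<in> X\<close> or of \<open>x\<^sub>0\<close>.
\<close>

section \<open>The full shift: compactness and cylinders\<close>

lemma topspace_full_shift [simp]: "topspace (full_shift G A) = carrier G \<rightarrow>\<^sub>E A"
  by (simp add: full_shift_def)

lemma compact_space_full_shift: "finite A \<Longrightarrow> compact_space (full_shift G A)"
  unfolding full_shift_def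
  by (simp add: compact_space_product_topology compact_space_discrete_topology)

text \<open>A basic box of the product topology restricts only finitely many coordinates, and since
  \<open>A\<close> is discrete it can be shrunk until it fixes the letters of \<open>x\<close>
  there. Later arguments read openness in this form, as agreement on a finite set.\<close>

lemma openin_full_shift:
  "openin (full_shift G A) U \<longleftrightarrow>
     U \<subseteq> carrier G \<rightarrow>\<^sub>E A \<and>
     (\<forall>x\<in>U. \<exists>S. finite S \<and> S \<subseteq> carrier G \<and>
        (\<forall>y\<in>carrier G \<rightarrow>\<^sub>E A. (\<forall>k\<in>S. x k = y k) \<longrightarrow> y \<in> U))"
  (is "?L \<longleftrightarrow> ?R")
proof
  assume L: ?L
  have "U \<subseteq> carrier G \<rightarrow>\<^sub>E A"
    using openin_subset[OF L] by simp
  moreover have "\<exists>S. finite S \<and> S \<subseteq> carrier G \<and>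
      (\<forall>y\<in>carrier G \<rightarrow>\<^sub>E A. (\<forall>k\<in>S. x k = y k) \<longrightarrow> y \<in> U)" if x: "x \<in> U" for x
  proof -
    obtain V where V: "finite {i \<in> carrier G. V i \<noteq> A}" "x \<in> Pi\<^sub>E (carrier G) V"
        "Pi\<^sub>E (carrier G) V \<subseteq> U"
      using L x unfolding full_shift_def openin_product_topology_alt topspace_discrete_topology
      by meson
    have "y \<in> U" if "y \<in> carrier G \<rightarrow>\<^sub>E A" "\<forall>k\<in>{i \<in> carrier G. V i \<noteq> A}. x k = y k" for y
    proof -
      have "y \<in> Pi\<^sub>E (carrier G) V"
        unfolding PiE_iff
      proof (intro conjI ballI)
        show "y \<in> extensional (carrier G)" using that(1) by (simp add: PiE_iff)
        show "y k \<in> V k" if k: "k \<in> carrier G" for k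
        proof (cases "V k = A")
          case True
          then show ?thesis using PiE_mem[OF \<open>y \<in> carrier G \<rightarrow>\<^sub>E A\<close> k] by simp
        next
          case False
          then have "y k = x k" using k \<open>\<forall>k\<in>_. x k = y k\<close> by simp
          then show ?thesis using PiE_mem[OF V(2) k] by simp
        qed
      qed
      then show ?thesis using V(3) by blast
    qed
    then show ?thesis using V(1) by (intro exI[of _ "{i \<in> carrier G. V i \<noteq> A}"]) auto
  qed
  ultimately show ?R by (intro conjI ballI)
next
  assume R: ?R
  show ?L
    unfolding full_shift_def openin_product_topology_alt
  proof
    fix x assume x: "x \<in> U"
    then obtain S where S: "finite S" "S \<subseteq> carrier G"
        "\<And>y. y \<in> carrier G \<rightarrow>\<^sub>E A \<Longrightarrow> \<forall>k\<in>S. x k = y k \<Longrightarrow> y \<in> U"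
      using R by meson
    define V where "V i = (if i \<in> S then {x i} else A)" for i
    have xA: "x \<in> carrier G \<rightarrow>\<^sub>E A" using R x by blast
    have "finite {i \<in> carrier G. V i \<noteq> A}"
      by (rule finite_subset[OF _ S(1)]) (auto simp: V_def)
    moreover have "\<forall>i\<in>carrier G. V i \<subseteq> A"
      using xA by (auto simp: V_def)
    moreover have "x \<in> Pi\<^sub>E (carrier G) V"
      using xA by (auto simp: V_def PiE_iff)
    moreover have "y \<in> U" if y: "y \<in> Pi\<^sub>E (carrier G) V" for y
    proof (rule S(3))
      show "y \<in> carrier G \<rightarrow>\<^sub>E A"
        using y \<open>\<forall>i\<in>carrier G. V i \<subseteq> A\<close> PiE_mono[of "carrier G" V "\<lambda>_. A"] by blast
      show "\<forall>k\<in>S. x k = y k"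
      proof
        fix k assume k: "k \<in> S"
        then have "y k \<in> V k" using y S(2) by (auto simp: PiE_iff)
        then show "x k = y k" using k by (simp add: V_def)
      qed
    qed
    ultimately show "\<exists>V. finite {i \<in> carrier G. V i \<noteq> topspace (discrete_topology A)} \<and>
        (\<forall>i\<in>carrier G. openin (discrete_topology A) (V i)) \<and>
        x \<in> Pi\<^sub>E (carrier G) V \<and> Pi\<^sub>E (carrier G) V \<subseteq> U"
      by (intro exI[of _ V]) auto
  qed
qed

lemma openin_full_shift_agree:
  assumes "finite S" "S \<subseteq> carrier G"
  shows "openin (full_shift G A) {y \<in> carrier G \<rightarrow>\<^sub>E A. \<forall>k\<in>S. x k = y k}"
  unfolding openin_full_shift using assms by force

section \<open>Membership in a subshift, read off from a window\<close>

text \<open>Any family \<open>F\<close> that defines \<open>X\<close> through \<open>W\<close> is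
  contained in \<open>forbidden G A X W\<close>, so avoiding the latter forces avoiding
  \<open>F\<close>.\<close>

lemma window_no_forbidden_imp_mem:
  assumes "is_window G A X W" "x \<in> carrier G \<rightarrow>\<^sub>E A"
    and "\<And>q. q \<in> forbidden G A X W \<Longrightarrow> \<not> appears G W q (carrier G) x"
  shows "x \<in> X"
proof -
  obtain F where F: "F \<subseteq> W \<rightarrow>\<^sub>E A"
      and X: "X = {x \<in> carrier G \<rightarrow>\<^sub>E A. \<forall>q\<in>F. \<not> appears G W q (carrier G) x}"
    using assms(1) unfolding is_window_def by blast
  have "F \<subseteq> forbidden G A X W"
    using F X unfolding forbidden_def by blast
  then show ?thesis using assms(2,3) X by blast
qed

context group
begin

lemma shift_apply: "g \<in> carrier G \<Longrightarrow> k \<in> carrier G \<Longrightarrow> shift G g x k = x (inv g \<otimes> k)"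
  by (simp add: shift_def)

lemma shift_in_full_shift:
  "g \<in> carrier G \<Longrightarrow> x \<in> carrier G \<rightarrow>\<^sub>E A \<Longrightarrow> shift G g x \<in> carrier G \<rightarrow>\<^sub>E A"
  by (auto simp: shift_def PiE_iff)

text \<open>A forbidden pattern appearing in \<open>z\<close> at \<open>g\<close> would appear at
  the same place in the configuration \<open>x\<close> chosen for that \<open>g\<close>. Since
  \<open>x\<close> may change with \<open>g\<close>, this puts points glued from different pieces
  into \<open>X\<close>.\<close>

lemma window_patchwise:
  assumes W: "is_window G A X W" and XA: "X \<subseteq> carrier G \<rightarrow>\<^sub>E A"
    and z: "z \<in> carrier G \<rightarrow>\<^sub>E A"
    and patch: "\<And>g. g \<in> carrier G \<Longrightarrow> \<exists>x\<in>X. \<forall>w\<in>W. z (g \<otimes> w) = x (g \<otimes> w)"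
  shows "z \<in> X"
proof (rule window_no_forbidden_imp_mem[OF W z])
  fix q assume q: "q \<in> forbidden G A X W"
  show "\<not> appears G W q (carrier G) z"
  proof
    assume "appears G W q (carrier G) z"
    then obtain g where g: "g \<in> carrier G" "g <# W \<subseteq> carrier G" "\<forall>w\<in>W. z (g \<otimes> w) = q w"
      unfolding appears_def by blast
    obtain x where "x \<in> X" "\<forall>w\<in>W. z (g \<otimes> w) = x (g \<otimes> w)"
      using patch[OF g(1)] by blast
    then have "appears G W q (carrier G) x" "x \<in> X"
      using g unfolding appears_def by fastforce+
    then show False using q unfolding forbidden_def by blast
  qed
qed

section \<open>Finite patterns: from local to global validity\<close>

text \<open>By compactness, finitely many places suffice to detect a forbidden pattern in every
  configuration whose restriction to \<open>M\<close> is not globally valid. The set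
  \<open>F\<close> contains \<open>M\<close> and the translates of \<open>W\<close> at these
  places.\<close>

lemma finite_locally_valid_imp_globally_valid:
  assumes "finite A" and W: "is_window G A X W" and M: "finite M" "M \<subseteq> carrier G"
  obtains F where "finite F" "F \<subseteq> carrier G" "M \<subseteq> F"
    "\<And>p. locally_valid G A X W F p \<Longrightarrow> globally_valid X M (restrict p M)"
proof -
  have WG: "finite W" "W \<subseteq> carrier G" using W unfolding is_window_def by auto
  define U where "U g = {x \<in> carrier G \<rightarrow>\<^sub>E A. \<exists>q\<in>forbidden G A X W. \<forall>w\<in>W. x (g \<otimes> w) = q w}" for g
  define V where "V = {x \<in> carrier G \<rightarrow>\<^sub>E A. \<exists>y\<in>X. \<forall>m\<in>M. x m = y m}"
  have oU: "openin (full_shift G A) (U g)" if g: "g \<in> carrier G" for g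
    unfolding openin_full_shift
  proof (intro conjI ballI)
    fix x assume x: "x \<in> U g"
    show "\<exists>S. finite S \<and> S \<subseteq> carrier G \<and>
        (\<forall>y\<in>carrier G \<rightarrow>\<^sub>E A. (\<forall>k\<in>S. x k = y k) \<longrightarrow> y \<in> U g)"
      using x WG g by (intro exI[of _ "(\<otimes>) g ` W"]) (auto simp: U_def)
  qed (auto simp: U_def)
  have oV: "openin (full_shift G A) V"
    unfolding openin_full_shift
  proof (intro conjI ballI)
    fix x assume x: "x \<in> V"
    show "\<exists>S. finite S \<and> S \<subseteq> carrier G \<and>
        (\<forall>y\<in>carrier G \<rightarrow>\<^sub>E A. (\<forall>k\<in>S. x k = y k) \<longrightarrow> y \<in> V)"
      using x M by (intro exI[of _ M]) (auto simp: V_def)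
  qed (auto simp: V_def)
  \<comment> \<open>A configuration in \<open>X\<close> is its own witness for \<open>V\<close>; any
    other one shows a forbidden pattern at some \<open>g\<close> and so lies in
    \<open>U g\<close>.\<close>
  have cover: "carrier G \<rightarrow>\<^sub>E A \<subseteq> \<Union> (insert V (U ` carrier G))"
  proof
    fix x assume x: "x \<in> carrier G \<rightarrow>\<^sub>E A"
    show "x \<in> \<Union> (insert V (U ` carrier G))"
    proof (cases "x \<in> X")
      case True
      then show ?thesis using x by (auto simp: V_def)
    next
      case False
      then obtain q g where "q \<in> forbidden G A X W" "g \<in> carrier G" "\<forall>w\<in>W. x (g \<otimes> w) = q w"
        using window_no_forbidden_imp_mem[OF W x] unfolding appears_def by blast
      then show ?thesis using x by (auto simp: U_def)
    qed
  qed
  have "compactin (full_shift G A) (carrier G \<rightarrow>\<^sub>E A)"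
    using compact_space_full_shift[OF \<open>finite A\<close>, of G] by (simp add: compact_space_def)
  moreover have "openin (full_shift G A) Y" if "Y \<in> insert V (U ` carrier G)" for Y
    using that oU oV by blast
  ultimately obtain \<F> where \<F>: "finite \<F>" "\<F> \<subseteq> insert V (U ` carrier G)"
      "carrier G \<rightarrow>\<^sub>E A \<subseteq> \<Union>\<F>"
    using compactinD[OF _ _ cover] by meson
  have "finite (\<F> - {V})" "\<F> - {V} \<subseteq> U ` carrier G" using \<F> by auto
  then obtain T where T: "T \<subseteq> carrier G" "finite T" "\<F> - {V} = U ` T"
    by (meson finite_subset_image)
  \<comment> \<open>The translates of \<open>W\<close> by \<open>t \<in> T\<close> let
    \<open>p\<close> itself display any forbidden pattern that would put its extension into
    \<open>U t\<close>. The element \<open>\<one>\<close> makes \<open>F\<close> nonempty, so that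
    \<open>p \<one>\<close> is a letter of \<open>A\<close>.\<close>
  define F where "F = insert \<one> (M \<union> (\<lambda>(t, w). t \<otimes> w) ` (T \<times> W))"
  have FG: "F \<subseteq> carrier G" using M T WG by (auto simp: F_def)
  show thesis
  proof
    show "finite F" using M T WG by (auto simp: F_def)
    show "M \<subseteq> F" by (auto simp: F_def)
    fix p assume p: "locally_valid G A X W F p"
    then have pA: "p \<in> F \<rightarrow>\<^sub>E A"
      and pf: "\<And>q. q \<in> forbidden G A X W \<Longrightarrow> \<not> appears G W q F p"
      unfolding locally_valid_def by auto
    have p1: "p \<one> \<in> A" using pA by (auto simp: F_def)
    \<comment> \<open>Filling up with a single letter may create forbidden patterns, but none at a
      place in \<open>T\<close>, and only these places occur in the finite subcover.\<close>
    define x where "x = (\<lambda>k\<in>carrier G. if k \<in> F then p k else p \<one>)"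
    have xA: "x \<in> carrier G \<rightarrow>\<^sub>E A" using pA p1 by (auto simp: x_def)
    have xF: "x k = p k" if "k \<in> F" for k using that FG by (auto simp: x_def)
    have "x \<notin> U t" if t: "t \<in> T" for t
    proof
      assume "x \<in> U t"
      then obtain q where q: "q \<in> forbidden G A X W" "\<forall>w\<in>W. x (t \<otimes> w) = q w"
        by (auto simp: U_def)
      have tw: "t \<otimes> w \<in> F" if "w \<in> W" for w using that t by (auto simp: F_def)
      then have "appears G W q F p"
        unfolding appears_def l_coset_def using t T(1) q(2) xF by fastforce
      then show False using pf q(1) by blast
    qed
    then have "x \<in> V" using \<F>(3) T(3) xA by blast
    then obtain y where y: "y \<in> X" "\<forall>m\<in>M. x m = y m" by (auto simp: V_def)
    then have "restrict p M = restrict y M"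
      using xF by (auto simp: F_def restrict_def)
    then show "globally_valid X M (restrict p M)"
      using y(1) unfolding globally_valid_def by auto
  qed (rule FG)
qed

section \<open>Local validity under translation\<close>

text \<open>An appearance at \<open>k\<close> in the translated pattern is an appearance at
  \<open>g \<otimes> k\<close> in \<open>q\<close>.\<close>

lemma locally_valid_translate:
  assumes q: "locally_valid G A X W E q" and W: "W \<subseteq> carrier G"
    and F: "F \<subseteq> carrier G" and g: "g \<in> carrier G" and gF: "g <# F \<subseteq> E"
  shows "locally_valid G A X W F (\<lambda>f\<in>F. q (g \<otimes> f))"
  unfolding locally_valid_def
proof (intro conjI ballI notI)
  show "(\<lambda>f\<in>F. q (g \<otimes> f)) \<in> F \<rightarrow>\<^sub>E A"
    using q gF by (auto simp: locally_valid_def l_coset_def PiE_iff)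
next
  fix r assume r: "r \<in> forbidden G A X W" and "appears G W r F (\<lambda>f\<in>F. q (g \<otimes> f))"
  then obtain k where k: "k \<in> carrier G" "k <# W \<subseteq> F"
      "\<forall>w\<in>W. (\<lambda>f\<in>F. q (g \<otimes> f)) (k \<otimes> w) = r w"
    unfolding appears_def by blast
  have kw: "k \<otimes> w \<in> F" if "w \<in> W" for w using k(2) that by (auto simp: l_coset_def)
  have eq: "g \<otimes> k \<otimes> w = g \<otimes> (k \<otimes> w)" if "w \<in> W" for w
    using that W g k(1) by (auto simp: m_assoc)
  have "g \<otimes> k <# W \<subseteq> E"
    using gF kw eq by (auto simp: l_coset_def)
  moreover have "\<forall>w\<in>W. q (g \<otimes> k \<otimes> w) = r w"
    using k(3) kw eq by auto
  ultimately have "appears G W r E q"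
    using g k(1) unfolding appears_def by blast
  then show False using q r unfolding locally_valid_def by blast
qed

text \<open>Pull \<open>q\<close> back by \<open>g\<close> to the fixed set \<open>F\<close>, take
  the configuration supplied there for \<open>M\<close>, and shift it by \<open>g\<close>. Thus one
  finite set \<open>F\<close> serves at every place of the group.\<close>

lemma locally_valid_patch:
  assumes X: "subshift G A X" and W: "W \<subseteq> carrier G"
    and F: "F \<subseteq> carrier G" "M \<subseteq> F"
      "\<And>p. locally_valid G A X W F p \<Longrightarrow> globally_valid X M (restrict p M)"
    and q: "locally_valid G A X W E q" and g: "g \<in> carrier G" and gF: "g <# F \<subseteq> E"
  shows "\<exists>x\<in>X. \<forall>m\<in>M. x (g \<otimes> m) = q (g \<otimes> m)"
proof -
  obtain y where y: "y \<in> X" "restrict (\<lambda>f\<in>F. q (g \<otimes> f)) M = restrict y M"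
    using F(3)[OF locally_valid_translate[OF q W F(1) g gF]] unfolding globally_valid_def by blast
  have "shift G g y (g \<otimes> m) = q (g \<otimes> m)" if m: "m \<in> M" for m
  proof -
    have mG: "m \<in> carrier G" using m F by auto
    have "shift G g y (g \<otimes> m) = y m"
      using mG g by (simp add: shift_apply flip: m_assoc)
    also have "\<dots> = q (g \<otimes> m)"
      using fun_cong[OF y(2), of m] m F(2) by auto
    finally show ?thesis .
  qed
  then show ?thesis using X y(1) g unfolding subshift_def by blast
qed

section \<open>Local rules of block maps\<close>

text \<open>This is the Curtis-Hedlund-Lyndon theorem for a map of three arguments. By continuity
  the value at \<open>\<one>\<close> depends, near each point, on finitely many coordinates;
  compactness yields one finite \<open>C\<close> for all points; equivariance carries the rule from
  \<open>\<one>\<close> to \<open>g\<close>.\<close>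

lemma block_map_local:
  fixes I :: "'i set" and h :: "('a \<Rightarrow> 'i) \<times> ('a \<Rightarrow> 'c) \<times> ('a \<Rightarrow> 'c) \<Rightarrow> 'a \<Rightarrow> 'c"
  assumes "finite A" "finite I" and X: "subshift G A X"
    and h: "block_map G
         (prod_topology (full_shift G I)
           (prod_topology (subtopology (full_shift G A) X) (subtopology (full_shift G A) X)))
         (\<lambda>g. map_prod (shift G g) (map_prod (shift G g) (shift G g)))
         (subtopology (full_shift G A) X) (shift G) h"
  obtains C where "finite C" "C \<subseteq> carrier G"
    "\<And>g i x y i' x' y'.
       \<lbrakk>g \<in> carrier G; i \<in> carrier G \<rightarrow>\<^sub>E I; x \<in> X; y \<in> X; i' \<in> carrier G \<rightarrow>\<^sub>E I; x' \<in> X; y' \<in> X;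
        \<And>c. c \<in> C \<Longrightarrow> i (g \<otimes> c) = i' (g \<otimes> c) \<and> x (g \<otimes> c) = x' (g \<otimes> c) \<and> y (g \<otimes> c) = y' (g \<otimes> c)\<rbrakk>
       \<Longrightarrow> h (i, x, y) g = h (i', x', y') g"
proof -
  let ?P = "prod_topology (full_shift G I)
           (prod_topology (subtopology (full_shift G A) X) (subtopology (full_shift G A) X))"
  have XA: "X \<subseteq> carrier G \<rightarrow>\<^sub>E A" and cX: "closedin (full_shift G A) X"
      and sX: "\<And>g x. g \<in> carrier G \<Longrightarrow> x \<in> X \<Longrightarrow> shift G g x \<in> X"
    using X closedin_subset unfolding subshift_def by fastforce+
  have topP: "topspace ?P = (carrier G \<rightarrow>\<^sub>E I) \<times> X \<times> X"
    using XA by auto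
  have "compact_space (subtopology (full_shift G A) X)"
    using closedin_compact_space[OF compact_space_full_shift[OF \<open>finite A\<close>] cX]
    by (simp add: compact_space_subtopology)
  then have compP: "compactin ?P (topspace ?P)"
    using compact_space_full_shift[OF \<open>finite I\<close>, of G]
    by (metis compact_space_def compact_space_prod_topology)
  have contA: "continuous_map ?P (discrete_topology A) (\<lambda>s. h s \<one>)"
  proof -
    have "continuous_map ?P (full_shift G A) h"
      using h unfolding block_map_def continuous_map_in_subtopology by blast
    then show ?thesis
      unfolding full_shift_def by (auto simp: continuous_map_componentwise)
  qed
  \<comment> \<open>These are the cylinders around \<open>s\<close>. One set \<open>S\<close> can
    serve all three components, since finite sets of coordinates may be united.\<close>
  define Z where "Z S s = {s' \<in> (carrier G \<rightarrow>\<^sub>E I) \<times> X \<times> X.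
      \<forall>k\<in>S. fst s k = fst s' k \<and> fst (snd s) k = fst (snd s') k \<and> snd (snd s) k = snd (snd s') k}"
    for S s
  have oZ: "openin ?P (Z S s)" if S: "finite S" "S \<subseteq> carrier G" for S s
  proof -
    have "Z S s = {y \<in> carrier G \<rightarrow>\<^sub>E I. \<forall>k\<in>S. fst s k = y k} \<times>
        ({y \<in> carrier G \<rightarrow>\<^sub>E A. \<forall>k\<in>S. fst (snd s) k = y k} \<inter> X) \<times>
        ({y \<in> carrier G \<rightarrow>\<^sub>E A. \<forall>k\<in>S. snd (snd s) k = y k} \<inter> X)"
      using XA by (auto simp: Z_def)
    moreover have "openin (subtopology (full_shift G A) X) ({y \<in> carrier G \<rightarrow>\<^sub>E A. \<forall>k\<in>S. x k = y k} \<inter> X)" for x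
      using openin_full_shift_agree[OF S] openin_subtopology_Int by blast
    ultimately show ?thesis
      using openin_full_shift_agree[OF S, of I "fst s"] by (simp add: openin_prod_Times_iff)
  qed
  \<comment> \<open>The preimage of \<open>{h s \<one>}\<close> is open because \<open>A\<close> is
    discrete. A product box inside it yields a finite set of coordinates for each factor.\<close>
  have "\<exists>S. finite S \<and> S \<subseteq> carrier G \<and> (\<forall>s'\<in>Z S s. h s' \<one> = h s \<one>)"
    if s: "s \<in> topspace ?P" for s
  proof -
    obtain i x y where sxy: "s = (i, x, y)" by (cases s)
    have "h s \<one> \<in> A" using contA s by (auto simp: continuous_map_def)
    then have "openin ?P {s' \<in> topspace ?P. h s' \<one> \<in> {h s \<one>}}" (is "openin _ ?O")
      using contA by (intro openin_continuous_map_preimage[OF contA]) auto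
    moreover have "(i, x, y) \<in> ?O" using s sxy by auto
    ultimately obtain U V where UV: "openin (full_shift G I) U"
        "openin (prod_topology (subtopology (full_shift G A) X) (subtopology (full_shift G A) X)) V"
        "i \<in> U" "(x, y) \<in> V" "U \<times> V \<subseteq> ?O"
      unfolding openin_prod_topology_alt by meson
    obtain U1 U2 where U12: "openin (subtopology (full_shift G A) X) U1"
        "openin (subtopology (full_shift G A) X) U2" "x \<in> U1" "y \<in> U2" "U1 \<times> U2 \<subseteq> V"
      using UV(2,4) unfolding openin_prod_topology_alt by meson
    obtain V1 V2 where V12: "openin (full_shift G A) V1" "U1 = V1 \<inter> X"
        "openin (full_shift G A) V2" "U2 = V2 \<inter> X"
      using U12 unfolding openin_subtopology by auto
    obtain S0 where S0: "finite S0" "S0 \<subseteq> carrier G"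
        "\<forall>y\<in>carrier G \<rightarrow>\<^sub>E I. (\<forall>k\<in>S0. i k = y k) \<longrightarrow> y \<in> U"
      using UV(1,3) unfolding openin_full_shift by meson
    obtain S1 where S1: "finite S1" "S1 \<subseteq> carrier G"
        "\<forall>y\<in>carrier G \<rightarrow>\<^sub>E A. (\<forall>k\<in>S1. x k = y k) \<longrightarrow> y \<in> V1"
      using V12(1,2) U12(3) unfolding openin_full_shift by (meson IntD1)
    obtain S2 where S2: "finite S2" "S2 \<subseteq> carrier G"
        "\<forall>z\<in>carrier G \<rightarrow>\<^sub>E A. (\<forall>k\<in>S2. y k = z k) \<longrightarrow> z \<in> V2"
      using V12(3,4) U12(4) unfolding openin_full_shift by (meson IntD1)
    have "Z (S0 \<union> S1 \<union> S2) s \<subseteq> U \<times> U1 \<times> U2"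
      using S0(3) S1(3) S2(3) XA unfolding Z_def V12 sxy by auto
    then have "\<forall>s'\<in>Z (S0 \<union> S1 \<union> S2) s. h s' \<one> = h s \<one>" using U12(5) UV(5) by blast
    moreover have "finite (S0 \<union> S1 \<union> S2)" "S0 \<union> S1 \<union> S2 \<subseteq> carrier G"
      using S0(1,2) S1(1,2) S2(1,2) by simp_all
    ultimately show ?thesis by (intro exI[of _ "S0 \<union> S1 \<union> S2"] conjI)
  qed
  then obtain S where S: "\<And>s. s \<in> topspace ?P \<Longrightarrow> finite (S s)"
      "\<And>s. s \<in> topspace ?P \<Longrightarrow> S s \<subseteq> carrier G"
      "\<And>s s'. s \<in> topspace ?P \<Longrightarrow> s' \<in> Z (S s) s \<Longrightarrow> h s' \<one> = h s \<one>"
    by metis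
  have "topspace ?P \<subseteq> \<Union> ((\<lambda>s. Z (S s) s) ` topspace ?P)"
    unfolding topP by (auto simp: Z_def)
  moreover have "openin ?P U" if "U \<in> (\<lambda>s. Z (S s) s) ` topspace ?P" for U
    using that oZ S by blast
  ultimately obtain \<F> where \<F>: "finite \<F>" "\<F> \<subseteq> (\<lambda>s. Z (S s) s) ` topspace ?P" "topspace ?P \<subseteq> \<Union>\<F>"
    using compactinD[OF compP] by meson
  then obtain T where T: "T \<subseteq> topspace ?P" "finite T" "\<F> = (\<lambda>s. Z (S s) s) ` T"
    by (meson finite_subset_image)
  define C where "C = \<Union> (S ` T)"
  have C: "finite C" "C \<subseteq> carrier G"
    using S(1,2) T unfolding C_def by blast+
  \<comment> \<open>The cylinder of some \<open>t \<in> T\<close> contains \<open>s\<close>. As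
    \<open>S t \<subseteq> C\<close>, it contains \<open>s'\<close> as well, and both values equal
    \<open>h t \<one>\<close>.\<close>
  have loc1: "h s \<one> = h s' \<one>" if s: "s \<in> topspace ?P" "s' \<in> Z C s" for s s'
  proof -
    obtain t where t: "t \<in> T" "s \<in> Z (S t) t" using \<F>(3) T(3) s(1) by blast
    then have "s' \<in> Z (S t) t" using s(2) unfolding Z_def C_def by auto
    then show ?thesis
      using S(3)[OF subsetD[OF T(1) t(1)]] t(2) by simp
  qed
  \<comment> \<open>Shifting by \<open>inv g\<close> moves what stands at \<open>g\<close> to
    \<open>\<one>\<close>.\<close>
  have hshift: "h (i, x, y) g = h (shift G (inv g) i, shift G (inv g) x, shift G (inv g) y) \<one>"
    if "g \<in> carrier G" "i \<in> carrier G \<rightarrow>\<^sub>E I" "x \<in> X" "y \<in> X" for g i x y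
  proof -
    have "h (map_prod (shift G (inv g)) (map_prod (shift G (inv g)) (shift G (inv g))) (i, x, y)) =
        shift G (inv g) (h (i, x, y))"
      using h that topP unfolding block_map_def
      by (metis (no_types, lifting) SigmaI inv_closed)
    then show ?thesis using that(1) by (simp add: shift_apply)
  qed
  show thesis
  proof (rule that[OF C])
    fix g i x y i' x' y'
    assume g: "g \<in> carrier G" and m: "i \<in> carrier G \<rightarrow>\<^sub>E I" "x \<in> X" "y \<in> X"
      and m': "i' \<in> carrier G \<rightarrow>\<^sub>E I" "x' \<in> X" "y' \<in> X"
      and agree: "\<And>c. c \<in> C \<Longrightarrow>
        i (g \<otimes> c) = i' (g \<otimes> c) \<and> x (g \<otimes> c) = x' (g \<otimes> c) \<and> y (g \<otimes> c) = y' (g \<otimes> c)"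
    have ig: "inv g \<in> carrier G" using g by simp
    have "(shift G (inv g) i', shift G (inv g) x', shift G (inv g) y') \<in>
        Z C (shift G (inv g) i, shift G (inv g) x, shift G (inv g) y)"
      unfolding Z_def
      using agree C(2) g by (auto simp: m' sX[OF ig] shift_in_full_shift[OF ig m'(1)] shift_apply subset_iff)
    moreover have "(shift G (inv g) i, shift G (inv g) x, shift G (inv g) y) \<in> topspace ?P"
      unfolding topP using m sX[OF ig] shift_in_full_shift[OF ig m(1)] by auto
    ultimately show "h (i, x, y) g = h (i', x', y') g"
      using hshift[OF g m] hshift[OF g m'] loc1 by simp
  qed
qed

end

section \<open>Contracting a locally valid pattern away from its core\<close>

theorem theorem1p6:
  fixes G :: "('g, 'm) monoid_scheme" and A :: "'a set" and X :: "('g \<Rightarrow> 'a) set"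
  assumes "group G" and "finite A"
    and "sft G A X" and "contractible_subshift G A X"
  shows "fep G A X"
proof -
  interpret group G by fact
  obtain W where W: "is_window G A X W" and X: "subshift G A X"
    using assms(3) unfolding sft_def by blast
  then have WG: "finite W" "W \<subseteq> carrier G" unfolding is_window_def by auto
  have XA: "X \<subseteq> carrier G \<rightarrow>\<^sub>E A"
    using X closedin_subset unfolding subshift_def by fastforce
  obtain h :: "('g \<Rightarrow> nat) \<times> ('g \<Rightarrow> 'a) \<times> ('g \<Rightarrow> 'a) \<Rightarrow> ('g \<Rightarrow> 'a)" where
    h: "block_map G
         (prod_topology (full_shift G {0, 1})
           (prod_topology (subtopology (full_shift G A) X) (subtopology (full_shift G A) X)))
         (\<lambda>g. map_prod (shift G g) (map_prod (shift G g) (shift G g)))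
         (subtopology (full_shift G A) X) (shift G) h"
    and h0: "\<And>x y. x \<in> X \<Longrightarrow> y \<in> X \<Longrightarrow> h ((\<lambda>_\<in>carrier G. 0), x, y) = x"
    and h1: "\<And>x y. x \<in> X \<Longrightarrow> y \<in> X \<Longrightarrow> h ((\<lambda>_\<in>carrier G. 1), x, y) = y"
    using assms(4) unfolding contractible_subshift_def by blast
  have fin01: "finite {0, 1 :: nat}" by simp
  obtain C0 where C0: "finite C0" "C0 \<subseteq> carrier G"
    "\<And>g i x y i' x' y'.
       \<lbrakk>g \<in> carrier G; i \<in> carrier G \<rightarrow>\<^sub>E {0, 1}; x \<in> X; y \<in> X; i' \<in> carrier G \<rightarrow>\<^sub>E {0, 1};
        x' \<in> X; y' \<in> X;
        \<And>c. c \<in> C0 \<Longrightarrow> i (g \<otimes>\<^bsub>G\<^esub> c) = i' (g \<otimes>\<^bsub>G\<^esub> c) \<and> x (g \<otimes>\<^bsub>G\<^esub> c) = x' (g \<otimes>\<^bsub>G\<^esub> c) \<and>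
          y (g \<otimes>\<^bsub>G\<^esub> c) = y' (g \<otimes>\<^bsub>G\<^esub> c)\<rbrakk>
       \<Longrightarrow> h (i, x, y) g = h (i', x', y') g"
    by (fact block_map_local[OF \<open>finite A\<close> fin01 X h])
  \<comment> \<open>With \<open>\<one>\<close> added, \<open>D\<close> lies in \<open>DC\<close>,
    and agreement on \<open>kC\<close> includes the place \<open>k\<close> itself.\<close>
  define C where "C = insert \<one>\<^bsub>G\<^esub> C0"
  have C: "finite C" "C \<subseteq> carrier G" "\<one>\<^bsub>G\<^esub> \<in> C" using C0 by (auto simp: C_def)
  have hC: "h (i, x, y) g = h (i', x', y) g"
    if "g \<in> carrier G" "i \<in> carrier G \<rightarrow>\<^sub>E {0, 1}" "x \<in> X" "y \<in> X" "i' \<in> carrier G \<rightarrow>\<^sub>E {0, 1}" "x' \<in> X"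
      "\<And>c. c \<in> C \<Longrightarrow> i (g \<otimes>\<^bsub>G\<^esub> c) = i' (g \<otimes>\<^bsub>G\<^esub> c)"
      "\<And>c. c \<in> C \<Longrightarrow> x (g \<otimes>\<^bsub>G\<^esub> c) = x' (g \<otimes>\<^bsub>G\<^esub> c)" for g i x y i' x'
    using that by (intro C0(3)) (auto simp: C_def)
  have hX: "h (i, x, y) \<in> X" if "i \<in> carrier G \<rightarrow>\<^sub>E {0, 1}" "x \<in> X" "y \<in> X" for i x y
  proof -
    have "h (i, x, y) \<in> topspace (subtopology (full_shift G A) X)"
      using h that XA unfolding block_map_def
      by (elim conjE continuous_map_image_subset_topspace[THEN subsetD]) (intro imageI, auto)
    then show ?thesis by simp
  qed
  \<comment> \<open>With \<open>\<one>\<close> added, single places of \<open>D\<close> are handled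
    by the same argument as translates of the window, even if \<open>W\<close> lacks the
    identity.\<close>
  define V where "V = insert \<one>\<^bsub>G\<^esub> W"
  have V: "finite V" "V \<subseteq> carrier G" "\<one>\<^bsub>G\<^esub> \<in> V" "W \<subseteq> V" using WG by (auto simp: V_def)
  \<comment> \<open>These are the places, relative to \<open>g\<close>, that the local rule reads
    when computing values on \<open>gV\<close>.\<close>
  define M where "M = V <#>\<^bsub>G\<^esub> C"
  have M: "finite M" "M \<subseteq> carrier G"
    using V C by (auto simp: M_def set_mult_def subset_iff)
  obtain F where F: "finite F" "F \<subseteq> carrier G" "M \<subseteq> F"
      "\<And>p. locally_valid G A X W F p \<Longrightarrow> globally_valid X M (restrict p M)"
    using finite_locally_valid_imp_globally_valid[OF \<open>finite A\<close> W M] by blast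
  \<comment> \<open>chosen so that \<open>gF \<subseteq> DN\<close> whenever \<open>gVC\<close> meets \<open>DC\<close>\<close>
  define N where "N = insert \<one>\<^bsub>G\<^esub>
    ((\<lambda>(c', c, v, f). c' \<otimes>\<^bsub>G\<^esub> inv\<^bsub>G\<^esub> c \<otimes>\<^bsub>G\<^esub> inv\<^bsub>G\<^esub> v \<otimes>\<^bsub>G\<^esub> f) ` (C \<times> C \<times> V \<times> F))"
  have N: "finite N" "N \<subseteq> carrier G" "\<one>\<^bsub>G\<^esub> \<in> N"
    using C V F by (auto simp: N_def subset_iff)
  have "globally_valid X D (restrict q D)"
    if D: "D \<subseteq> carrier G" "D \<noteq> {}" and q: "locally_valid G A X W (D <#>\<^bsub>G\<^esub> N) q" for D q
  proof -
    let ?DC = "D <#>\<^bsub>G\<^esub> C"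
    \<comment> \<open>A single configuration serves the whole of \<open>gVC\<close>; later this lets
      the patch of \<open>z\<close> on \<open>gW\<close> come from one value of \<open>h\<close>. If
      \<open>gvc = dc'\<close>, then solving for \<open>g\<close> gives
      \<open>gF \<subseteq> DN\<close> by the form of \<open>N\<close>.\<close>
    have near: "\<exists>x\<in>X. \<forall>v\<in>V. \<forall>c\<in>C. x (g \<otimes>\<^bsub>G\<^esub> v \<otimes>\<^bsub>G\<^esub> c) = q (g \<otimes>\<^bsub>G\<^esub> v \<otimes>\<^bsub>G\<^esub> c)"
      if g: "g \<in> carrier G" and vc: "v \<in> V" "c \<in> C" "g \<otimes>\<^bsub>G\<^esub> v \<otimes>\<^bsub>G\<^esub> c \<in> ?DC" for g v c
    proof -
      obtain d c' where d: "d \<in> D" "c' \<in> C" "g \<otimes>\<^bsub>G\<^esub> v \<otimes>\<^bsub>G\<^esub> c = d \<otimes>\<^bsub>G\<^esub> c'"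
        using vc(3) by (auto simp: set_mult_def)
      have cG: "v \<in> carrier G" "c \<in> carrier G" "c' \<in> carrier G" "d \<in> carrier G"
        using vc d V C D by auto
      have geq: "g = d \<otimes>\<^bsub>G\<^esub> (c' \<otimes>\<^bsub>G\<^esub> inv\<^bsub>G\<^esub> c \<otimes>\<^bsub>G\<^esub> inv\<^bsub>G\<^esub> v)"
        using d(3) g cG by (metis inv_closed inv_solve_right m_assoc m_closed)
      have "g <#\<^bsub>G\<^esub> F \<subseteq> D <#>\<^bsub>G\<^esub> N"
      proof
        fix k assume "k \<in> g <#\<^bsub>G\<^esub> F"
        then obtain f where f: "f \<in> F" "k = g \<otimes>\<^bsub>G\<^esub> f" by (auto simp: l_coset_def)
        then have "k = d \<otimes>\<^bsub>G\<^esub> (c' \<otimes>\<^bsub>G\<^esub> inv\<^bsub>G\<^esub> c \<otimes>\<^bsub>G\<^esub> inv\<^bsub>G\<^esub> v \<otimes>\<^bsub>G\<^esub> f)"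
          using cG F(2) unfolding geq by (auto intro!: m_assoc)
        moreover have "c' \<otimes>\<^bsub>G\<^esub> inv\<^bsub>G\<^esub> c \<otimes>\<^bsub>G\<^esub> inv\<^bsub>G\<^esub> v \<otimes>\<^bsub>G\<^esub> f \<in> N"
          unfolding N_def using d(2) vc f(1) by (intro insertI2 image_eqI[of _ _ "(c', c, v, f)"]) auto
        ultimately show "k \<in> D <#>\<^bsub>G\<^esub> N" using d(1) by (simp add: set_mult_def) blast
      qed
      then obtain x where x: "x \<in> X" "\<forall>m\<in>M. x (g \<otimes>\<^bsub>G\<^esub> m) = q (g \<otimes>\<^bsub>G\<^esub> m)"
        using locally_valid_patch[OF X WG(2) F(2-4) q g] by blast
      have "x (g \<otimes>\<^bsub>G\<^esub> v \<otimes>\<^bsub>G\<^esub> c) = q (g \<otimes>\<^bsub>G\<^esub> v \<otimes>\<^bsub>G\<^esub> c)" if "v \<in> V" "c \<in> C" for v c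
      proof -
        have "g \<otimes>\<^bsub>G\<^esub> v \<otimes>\<^bsub>G\<^esub> c = g \<otimes>\<^bsub>G\<^esub> (v \<otimes>\<^bsub>G\<^esub> c)"
          by (intro m_assoc) (use that g V C in auto)
        moreover have "v \<otimes>\<^bsub>G\<^esub> c \<in> M" using that by (auto simp: M_def set_mult_def)
        ultimately show ?thesis using x(2) by simp
      qed
      then show ?thesis using x(1) by blast
    qed
    have nearD: "\<exists>x\<in>X. \<forall>c\<in>C. x (d \<otimes>\<^bsub>G\<^esub> c) = q (d \<otimes>\<^bsub>G\<^esub> c)" if d: "d \<in> D" for d
    proof -
      have dG: "d \<in> carrier G" using d D by auto
      have "d \<otimes>\<^bsub>G\<^esub> \<one>\<^bsub>G\<^esub> \<otimes>\<^bsub>G\<^esub> \<one>\<^bsub>G\<^esub> \<in> ?DC" using d dG C(3) by (force simp: set_mult_def)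
      from near[OF dG V(3) C(3) this] V(3) dG show ?thesis by (metis r_one)
    qed
    \<comment> \<open>The target of the contraction; it exists because \<open>D\<close> is
      nonempty.\<close>
    obtain x0 where x0: "x0 \<in> X" using nearD D(2) by blast
    \<comment> \<open>The switch vanishes on \<open>DC\<close> rather than only on \<open>D\<close>,
      so that the local rule reads nothing but zeros when evaluated at a point of
      \<open>D\<close>.\<close>
    define \<phi> :: "'g \<Rightarrow> nat" where "\<phi> = (\<lambda>k\<in>carrier G. if k \<in> ?DC then 0 else 1)"
    have \<phi>: "\<phi> \<in> carrier G \<rightarrow>\<^sub>E {0, 1}" by (auto simp: \<phi>_def)
    have zero: "(\<lambda>_\<in>carrier G. 0) \<in> carrier G \<rightarrow>\<^sub>E {0, 1 :: nat}"
      and one: "(\<lambda>_\<in>carrier G. 1) \<in> carrier G \<rightarrow>\<^sub>E {0, 1 :: nat}" by auto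
    \<comment> \<open>Since \<open>q\<close> need not extend to a configuration, \<open>h\<close>
      cannot be applied to it directly; \<open>\<xi> k\<close> stands in for it on
      \<open>kC\<close>. The implication makes the choice total: where \<open>q\<close> has no valid
      patch on \<open>kC\<close>, any element of \<open>X\<close> will do.\<close>
    have "\<exists>x\<in>X. (\<exists>x'\<in>X. \<forall>c\<in>C. x' (k \<otimes>\<^bsub>G\<^esub> c) = q (k \<otimes>\<^bsub>G\<^esub> c)) \<longrightarrow>
        (\<forall>c\<in>C. x (k \<otimes>\<^bsub>G\<^esub> c) = q (k \<otimes>\<^bsub>G\<^esub> c))" for k
      using x0 by blast
    then obtain \<xi> where \<xi>X: "\<And>k. \<xi> k \<in> X"
      and \<xi>: "\<And>k x' c. x' \<in> X \<Longrightarrow> \<forall>c\<in>C. x' (k \<otimes>\<^bsub>G\<^esub> c) = q (k \<otimes>\<^bsub>G\<^esub> c) \<Longrightarrow> c \<in> C \<Longrightarrow>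
        \<xi> k (k \<otimes>\<^bsub>G\<^esub> c) = q (k \<otimes>\<^bsub>G\<^esub> c)"
      by metis
    \<comment> \<open>As \<open>\<xi> k\<close> varies with \<open>k\<close>, \<open>z\<close> is
      not given as a value of \<open>h\<close>; hence its membership in \<open>X\<close> is checked
      patch by patch.\<close>
    define z where "z = (\<lambda>k\<in>carrier G. h (\<phi>, \<xi> k, x0) k)"
    have zA: "z \<in> carrier G \<rightarrow>\<^sub>E A"
      using hX[OF \<phi> \<xi>X x0] XA by (fastforce simp: z_def)
    have "z \<in> X"
    proof (rule window_patchwise[OF W XA zA])
      fix g assume g: "g \<in> carrier G"
      show "\<exists>x\<in>X. \<forall>w\<in>W. z (g \<otimes>\<^bsub>G\<^esub> w) = x (g \<otimes>\<^bsub>G\<^esub> w)"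
      proof (cases "\<exists>v\<in>V. \<exists>c\<in>C. g \<otimes>\<^bsub>G\<^esub> v \<otimes>\<^bsub>G\<^esub> c \<in> ?DC")
        case True
        then obtain x where x: "x \<in> X"
            "\<forall>v\<in>V. \<forall>c\<in>C. x (g \<otimes>\<^bsub>G\<^esub> v \<otimes>\<^bsub>G\<^esub> c) = q (g \<otimes>\<^bsub>G\<^esub> v \<otimes>\<^bsub>G\<^esub> c)"
          using near[OF g] by blast
        \<comment> \<open>Both \<open>x\<close> and \<open>\<xi> (g \<otimes> w)\<close> agree with
          \<open>q\<close> on \<open>gwC\<close>, which is all the local rule reads of them at
          \<open>gw\<close>.\<close>
        have "z (g \<otimes>\<^bsub>G\<^esub> w) = h (\<phi>, x, x0) (g \<otimes>\<^bsub>G\<^esub> w)" if w: "w \<in> W" for w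
        proof -
          have gw: "g \<otimes>\<^bsub>G\<^esub> w \<in> carrier G" "w \<in> V" using w WG V g by auto
          show ?thesis unfolding z_def using gw(1)
            by (simp, intro hC \<phi> \<xi>X x0 x refl) (use \<xi>[OF x(1)] x(2) gw(2) in auto)
        qed
        then show ?thesis using hX[OF \<phi> x(1) x0] by blast
      next
        case False
        \<comment> \<open>No \<open>gwC\<close> meets \<open>DC\<close>, so the rule reads only ones
          and returns \<open>x0\<close> whatever \<open>\<xi>\<close> supplies.\<close>
        have "z (g \<otimes>\<^bsub>G\<^esub> w) = x0 (g \<otimes>\<^bsub>G\<^esub> w)" if w: "w \<in> W" for w
        proof -
          have gw: "g \<otimes>\<^bsub>G\<^esub> w \<in> carrier G" "w \<in> V" using w WG V g by auto
          have "h (\<phi>, \<xi> (g \<otimes>\<^bsub>G\<^esub> w), x0) (g \<otimes>\<^bsub>G\<^esub> w) =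
              h ((\<lambda>_\<in>carrier G. 1), \<xi> (g \<otimes>\<^bsub>G\<^esub> w), x0) (g \<otimes>\<^bsub>G\<^esub> w)"
            by (intro hC gw \<phi> \<xi>X x0 one refl) (use False gw C(2) in \<open>auto simp: \<phi>_def\<close>)
          then show ?thesis using gw h1[OF \<xi>X x0] by (simp add: z_def)
        qed
        then show ?thesis using x0 by blast
      qed
    qed
    have "z d = q d" if d: "d \<in> D" for d
    proof -
      have dG: "d \<in> carrier G" using d D by auto
      obtain x where x: "x \<in> X" "\<forall>c\<in>C. x (d \<otimes>\<^bsub>G\<^esub> c) = q (d \<otimes>\<^bsub>G\<^esub> c)" using nearD[OF d] by blast
      \<comment> \<open>Here \<open>dC \<subseteq> DC\<close>, so the contraction leaves
        \<open>\<xi> d\<close> unchanged at \<open>d\<close>, where it agrees with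
        \<open>q\<close>.\<close>
      have "h (\<phi>, \<xi> d, x0) d = h ((\<lambda>_\<in>carrier G. 0), \<xi> d, x0) d"
        by (intro hC dG \<phi> \<xi>X x0 zero refl) (use d dG C(2) in \<open>auto simp: \<phi>_def set_mult_def\<close>)
      then have "z d = \<xi> d d" using dG h0[OF \<xi>X x0] by (simp add: z_def)
      then show ?thesis using \<xi>[OF x C(3)] dG by simp
    qed
    then have "restrict q D = restrict z D" by (intro restrict_ext) simp
    with \<open>z \<in> X\<close> show ?thesis unfolding globally_valid_def by blast
  qed
  then show ?thesis
    unfolding fep_def using W N by blast
qed

end
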